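(* Let $k\ge 1$ and let $A$ be a $k\times k$ complex matrix with characteristic polynomial $P$. Then for every $0\le j\le k-1$ and every integer $n\ge k$, $$b_j(n)=-\frac{1}{2\pi \mathrm{i}}\int_{\mathcal{C}}s^{n-j-1}\,\frac{p_j(s)}{P(s)}\,ds,$$ where $\mathcal{C}$ is a (positively oriented) circle of radius $R>\rho(A)$ centered at the origin.
   Context: Write the characteristic polynomial of the $k\times k$ matrix $A$ as $P(x)=x^{k}+\sum_{j=0}^{k-1}a_jx^{j}$. The numbers $b_j(n)$, for $0\le j\le k-1$ and integers $n\ge k$, are defined recursively by $b_j(k)=-a_j$ for $0\le j\le k-1$, the convention $b_{-1}(n)=0$ for $n\ge k$, and $b_j(n+1)=b_{j-1}(n)-a_j\,b_{k-1}(n)$ for $n\ge k$, $0\le j\le k-1$. (They satisfy $A^n=\sum_{j=0}^{k-1}b_j(n)A^j$ for $n\ge k$.) The polynomials $p_j$ are $p_j(s)=\sum_{l=0}^{j}a_l s^{l}$, $0\le j\le k-1$. The spectral radius is $\rho(A)=\max\{|\mu| : P(\mu)=0\}$. *)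

theory Defs
  imports "HOL-Complex_Analysis.Complex_Analysis" "Jordan_Normal_Form.Spectral_Radius"
begin

abbreviation char_coeff :: "complex mat \<Rightarrow> nat \<Rightarrow> complex" where
  "char_coeff A j \<equiv> poly.coeff (char_poly A) j"

text \<open>
  \<open>pow_coeff A n j\<close> is meant for \<open>n \<ge> dim_row A\<close> and \<open>j < dim_row A\<close>; the two lemmas
  after the definition give the defining recursion on that range. The values for
  \<open>n < dim_row A\<close> are arbitrary and do not enter the values for \<open>n \<ge> dim_row A\<close>.
  The test \<open>j = 0\<close> encodes the convention that the entry with index \<open>-1\<close> is zero.
\<close>

primrec pow_coeff :: "complex mat \<Rightarrow> nat \<Rightarrow> nat \<Rightarrow> complex" where
  "pow_coeff A 0 j = - char_coeff A j"
| "pow_coeff A (Suc n) j =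
    (if Suc n \<le> dim_row A then - char_coeff A j
     else (if j = 0 then 0 else pow_coeff A n (j - 1))
       - char_coeff A j * pow_coeff A n (dim_row A - 1))"

lemma pow_coeff_start: "pow_coeff A (dim_row A) j = - char_coeff A j"
  by (cases "dim_row A") auto

lemma pow_coeff_step:
  assumes "n \<ge> dim_row A"
  shows "pow_coeff A (n + 1) j =
    (if j = 0 then 0 else pow_coeff A n (j - 1))
      - char_coeff A j * pow_coeff A n (dim_row A - 1)"
  using assms by simp

definition char_partial :: "complex mat \<Rightarrow> nat \<Rightarrow> complex \<Rightarrow> complex" where
  "char_partial A j s = (\<Sum>l = 0..j. char_coeff A l * s ^ l)"

text \<open>The library's spectral radius, in terms of the roots of the characteristic polynomial.\<close>

lemma spectral_radius_roots:
  assumes "A \<in> carrier_mat k k"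
  shows "spectral_radius A = Max {cmod \<mu> |\<mu>. poly (char_poly A) \<mu> = 0}"
proof -
  have "norm ` spectrum A = {cmod \<mu> |\<mu>. poly (char_poly A) \<mu> = 0}"
    using eigenvalue_root_char_poly[OF assms] unfolding spectrum_def by auto
  then show ?thesis unfolding spectral_radius_def by simp
qed

text \<open>On the circles considered, the integrand below is continuous, so its
  \<^const>\<open>contour_integral\<close> is a genuine value and not the default one.\<close>

lemma integrand_contour_integrable:
  assumes A: "A \<in> carrier_mat k k" and k: "k \<ge> 1" and R: "R > spectral_radius A"
  shows "(\<lambda>s. s ^ (n - j - 1) * (char_partial A j s / poly (char_poly A) s))
    contour_integrable_on circlepath 0 R"
proof (rule contour_integrable_continuous_circlepath)
  have dim: "k > 0" using k by simp
  have "spectral_radius A \<ge> 0"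
    using spectral_radius_mem_max(1)[OF A dim] by auto
  then have "R > 0" using R by simp
  have "poly (char_poly A) s \<noteq> 0" if "cmod s = R" for s
  proof
    assume "poly (char_poly A) s = 0"
    then have "cmod s \<in> norm ` spectrum A"
      using eigenvalue_root_char_poly[OF A] unfolding spectrum_def by auto
    from spectral_radius_mem_max(2)[OF A dim this] show False using R that by simp
  qed
  then show "continuous_on (path_image (circlepath 0 R))
      (\<lambda>s. s ^ (n - j - 1) * (char_partial A j s / poly (char_poly A) s))"
    using \<open>R > 0\<close> unfolding char_partial_def
    by (intro continuous_intros) (auto simp: path_image_circlepath)
qed

end

theory Submission
  imports Defs
begin

text \<open>
  Write \<open>P\<close> for the characteristic polynomial of \<open>A\<close>, let \<open>a\<^sub>j\<close> be its coefficients and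
  \<open>p\<^sub>j\<close> its partial sums, and let \<open>I(n, j)\<close> be the right-hand side of the claimed formula.
  The two sides agree because \<open>I\<close> satisfies the same initial condition and the same
  recursion as the coefficients \<open>b\<^sub>j(n)\<close>.

  For the recursion, split \<open>p\<^sub>j(s) = p\<^bsub>j-1\<^esub>(s) + a\<^sub>j s\<^sup>j\<close>. Then
  \<open>s\<^bsup>n-j\<^esup> p\<^sub>j(s) = s\<^bsup>n-(j-1)-1\<^esup> p\<^bsub>j-1\<^esub>(s) + a\<^sub>j s\<^sup>n\<close>, so that \<open>I(n+1, j)\<close> equals
  \<open>I(n, j-1)\<close>, or \<open>0\<close> if \<open>j = 0\<close>, minus \<open>a\<^sub>j\<close> times the integral of
  \<open>s\<^sup>n / P(s)\<close> divided by \<open>2 \<pi> \<i>\<close>. The latter is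
  \<open>I(n, k-1)\<close>: since \<open>P\<close> is monic of degree \<open>k\<close>, \<open>p\<^bsub>k-1\<^esub>(s) = P(s) - s\<^sup>k\<close>, so
  \<open>- s\<^bsup>n-k\<^esup> p\<^bsub>k-1\<^esub>(s) / P(s)\<close> and \<open>s\<^sup>n / P(s)\<close> differ only by the polynomial
  \<open>s\<^bsup>n-k\<^esup>\<close>, whose integral over a closed curve vanishes.

  For the initial condition \<open>I(k, j) = - a\<^sub>j\<close>, all roots of \<open>P\<close> lie inside the circle, so the
  integral is determined by the behaviour of the integrand at infinity: if \<open>s f(s)\<close> tends to
  \<open>c\<close>, the integral is \<open>2 \<pi> \<i> c\<close>
  (lemma \<open>contour_integral_circlepath_eq_limit_at_infinity\<close>). Here
  \<open>s \<cdot> s\<^bsup>k-j-1\<^esup> p\<^sub>j(s) / P(s) = (p\<^sub>j(s) / s\<^sup>j) / (P(s) / s\<^sup>k)\<close>, which tends to \<open>a\<^sub>j\<close>.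
\<close>

section \<open>Circle integrals and the behaviour at infinity\<close>

text \<open>
  Both circles wind once around every singularity, so by the residue theorem both integrals
  equal \<open>2 \<pi> \<i>\<close> times the sum of all residues.
\<close>

lemma contour_integral_circlepath_radius_independent:
  assumes "finite pts" "f holomorphic_on - pts" "pts \<subseteq> ball z r" "r \<le> r'" "0 < r"
  shows "contour_integral (circlepath z r') f = contour_integral (circlepath z r) f"
proof -
  have *: "contour_integral (circlepath z \<rho>) f = 2 * pi * \<i> * (\<Sum>p\<in>pts. residue f p)"
    if "r \<le> \<rho>" for \<rho>
  proof -
    have inside: "dist p z < \<rho>" if "p \<in> pts" for p
      using assms(3) that \<open>r \<le> \<rho>\<close> by (force simp: dist_commute)
    have "contour_integral (circlepath z \<rho>) f =
        2 * pi * \<i> * (\<Sum>p\<in>pts. winding_number (circlepath z \<rho>) p * residue f p)"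
    proof (rule Residue_theorem[where S = UNIV])
      show "path_image (circlepath z \<rho>) \<subseteq> UNIV - pts"
        using inside that assms(5) by (force simp: path_image_circlepath dist_commute)
    qed (use assms in \<open>auto simp: Compl_eq_Diff_UNIV\<close>)
    also have "(\<Sum>p\<in>pts. winding_number (circlepath z \<rho>) p * residue f p) =
        (\<Sum>p\<in>pts. residue f p)"
      using inside by (intro sum.cong) (auto simp: winding_number_circlepath dist_norm)
    finally show ?thesis .
  qed
  show ?thesis using *[of r] *[of r'] assms(4) by simp
qed

text \<open>
  The limit \<open>c\<close> is the negative of the residue at infinity. On a circle of large radius \<open>r\<close>, the
  function differs from \<open>c / s\<close>, whose integral is \<open>2 \<pi> \<i> c\<close>, by at most \<open>\<epsilon> / r\<close>, so the
  integrals differ by at most \<open>2 \<pi> \<epsilon>\<close>; and the integral does not depend on the radius.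
\<close>

lemma contour_integral_circlepath_eq_limit_at_infinity:
  assumes pts: "finite pts" "f holomorphic_on - pts" "pts \<subseteq> ball 0 R" and R: "0 < R"
    and lim: "((\<lambda>s. s * f s) \<longlongrightarrow> c) at_infinity"
  shows "contour_integral (circlepath 0 R) f = 2 * of_real pi * \<i> * c"
proof -
  define J where "J = contour_integral (circlepath 0 R) f"
  have bound: "norm (J - 2 * of_real pi * \<i> * c) \<le> \<epsilon> * (2 * pi)" if \<epsilon>: "\<epsilon> > 0" for \<epsilon> :: real
  proof -
    obtain b where b: "\<And>s. b \<le> norm s \<Longrightarrow> norm (s * f s - c) < \<epsilon>"
      using tendstoD[OF lim \<epsilon>] unfolding eventually_at_infinity dist_norm by blast
    define r where "r = max b R"
    have r: "r > 0" "b \<le> r" "R \<le> r" using R by (auto simp: r_def)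
    have "f contour_integrable_on circlepath 0 r"
    proof (rule contour_integrable_continuous_circlepath)
      have "path_image (circlepath 0 r) \<subseteq> - pts"
        using pts(3) r by (force simp: path_image_circlepath)
      then show "continuous_on (path_image (circlepath 0 r)) f"
        using pts(2) holomorphic_on_imp_continuous_on continuous_on_subset by blast
    qed
    moreover have "J = contour_integral (circlepath 0 r) f"
      unfolding J_def
      using contour_integral_circlepath_radius_independent[OF pts r(3) R] by simp
    ultimately have 1: "(f has_contour_integral J) (circlepath 0 r)"
      by (simp add: has_contour_integral_integral)
    have "(\<lambda>s. 1 / (s - 0)) contour_integrable_on circlepath (0::complex) r"
      using r by (intro contour_integrable_continuous_circlepath continuous_intros) auto
    then have "((\<lambda>s. 1 / (s - 0)) has_contour_integral 2 * of_real pi * \<i>) (circlepath 0 r)"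
      using contour_integral_circlepath[OF r(1), of 0] has_contour_integral_integral by metis
    from has_contour_integral_diff[OF 1 has_contour_integral_lmul[OF this, of c]]
    have "((\<lambda>s. f s - c / s) has_contour_integral (J - 2 * of_real pi * \<i> * c)) (circlepath 0 r)"
      by (simp add: mult_ac)
    then have "norm (J - 2 * of_real pi * \<i> * c) \<le> (\<epsilon> / r) * (2 * pi * r)"
    proof (rule has_contour_integral_bound_circlepath)
      fix s :: complex assume "norm (s - 0) = r"
      then have s: "norm s = r" "s \<noteq> 0" using r by auto
      have "f s - c / s = (s * f s - c) / s" using s by (simp add: field_simps)
      then have "norm (f s - c / s) = norm (s * f s - c) / r"
        using s by (simp add: norm_divide)
      also have "\<dots> \<le> \<epsilon> / r"
        using b[of s] s r by (intro divide_right_mono) auto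
      finally show "norm (f s - c / s) \<le> \<epsilon> / r" .
    qed (use r \<epsilon> in auto)
    then show ?thesis using r by simp
  qed
  have "norm (J - 2 * of_real pi * \<i> * c) \<le> 0"
  proof (rule field_le_epsilon)
    fix e :: real assume "e > 0"
    then show "norm (J - 2 * of_real pi * \<i> * c) \<le> 0 + e"
      using bound[of "e / (2 * pi)"] by simp
  qed
  then show ?thesis by (simp add: J_def)
qed

section \<open>Partial sums of the characteristic polynomial\<close>

lemma char_partial_0: "char_partial A 0 s = char_coeff A 0"
  by (simp add: char_partial_def)

lemma char_partial_Suc:
  "char_partial A (Suc j) s = char_partial A j s + char_coeff A (Suc j) * s ^ Suc j"
  by (simp add: char_partial_def)

lemma poly_char_poly_eq_char_partial:
  assumes "A \<in> carrier_mat k k" "k \<ge> 1"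
  shows "poly (char_poly A) s = char_partial A (k - 1) s + s ^ k"
proof -
  obtain m where m: "k = Suc m" using assms(2) by (cases k) auto
  show ?thesis
    using degree_monic_char_poly[OF assms(1)]
    by (simp add: poly_altdef char_partial_def m atLeast0AtMost)
qed

lemma char_partial_over_power_tendsto:
  "((\<lambda>s. char_partial A j s / s ^ j) \<longlongrightarrow> char_coeff A j) at_infinity"
proof (cases j)
  case 0
  then show ?thesis by (simp add: char_partial_0)
next
  case (Suc m)
  define q where "q = (\<Sum>l = 0..m. monom (char_coeff A l) l)"
  have "degree q \<le> m"
    unfolding q_def by (intro degree_sum_le) (auto intro: order_trans[OF degree_monom_le])
  then have "degree q < degree (monom (1::complex) j)"
    by (simp add: degree_monom_eq Suc)
  from poly_divide_tendsto_0_at_infinity[OF this]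
  have "((\<lambda>s. char_partial A m s / s ^ j) \<longlongrightarrow> 0) at_infinity"
    by (simp add: q_def poly_sum poly_monom char_partial_def)
  then have "((\<lambda>s. char_partial A m s / s ^ j + char_coeff A j) \<longlongrightarrow> 0 + char_coeff A j) at_infinity"
    by (intro tendsto_intros)
  moreover have "\<forall>\<^sub>F s in at_infinity. char_partial A m s / s ^ j + char_coeff A j =
      char_partial A j s / s ^ j"
    unfolding eventually_at_infinity
    by (rule exI[of _ 1])
      (auto simp: Suc char_partial_Suc add_divide_distrib simp del: power_Suc)
  ultimately show ?thesis by (simp add: Lim_transform_eventually)
qed

section \<open>The integral representation\<close>

lemma norm_less_if_char_poly_root:
  assumes "A \<in> carrier_mat k k" "k \<ge> 1" "R > spectral_radius A" "poly (char_poly A) s = 0"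
  shows "norm s < R"
proof -
  have "norm s \<in> norm ` spectrum A"
    using eigenvalue_root_char_poly[OF assms(1)] assms(4) unfolding spectrum_def by auto
  from spectral_radius_mem_max(2)[OF assms(1) _ this] assms(2,3) show ?thesis by simp
qed

lemma spectral_radius_nonneg:
  assumes "A \<in> carrier_mat k k" "k \<ge> 1"
  shows "spectral_radius A \<ge> 0"
  using spectral_radius_mem_max(1)[OF assms(1)] assms(2) by auto

lemma contour_integral_initial:
  assumes A: "A \<in> carrier_mat k k" and k: "k \<ge> 1" and j: "j \<le> k - 1"
    and R: "R > spectral_radius A"
  shows "contour_integral (circlepath 0 R)
      (\<lambda>s. s ^ (k - j - 1) * (char_partial A j s / poly (char_poly A) s)) =
    2 * of_real pi * \<i> * char_coeff A j"
proof (rule contour_integral_circlepath_eq_limit_at_infinity)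
  let ?P = "char_poly A"
  let ?Z = "{s. poly ?P s = 0}"
  have monic: "degree ?P = k" "coeff ?P k = 1" using degree_monic_char_poly[OF A] by auto
  then have "?P \<noteq> 0" by auto
  then show "finite ?Z" by (rule poly_roots_finite)
  show "(\<lambda>s. s ^ (k - j - 1) * (char_partial A j s / poly ?P s)) holomorphic_on - ?Z"
    unfolding char_partial_def by (intro holomorphic_intros) auto
  show "?Z \<subseteq> ball 0 R" using norm_less_if_char_poly_root[OF A k R] by auto
  show "0 < R" using spectral_radius_nonneg[OF A k] R by simp
  have "((\<lambda>s. poly ?P s / s ^ k) \<longlongrightarrow> 1) at_infinity"
    using poly_divide_tendsto_aux[of ?P] monic by simp
  from tendsto_divide[OF char_partial_over_power_tendsto[of A j] this]
  have "((\<lambda>s. (char_partial A j s / s ^ j) / (poly ?P s / s ^ k)) \<longlongrightarrow> char_coeff A j) at_infinity"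
    by simp
  moreover have "\<forall>\<^sub>F s in at_infinity. (char_partial A j s / s ^ j) / (poly ?P s / s ^ k) =
      s * (s ^ (k - j - 1) * (char_partial A j s / poly ?P s))"
    unfolding eventually_at_infinity
  \<comment> \<open>Any positive bound would do: it only has to exclude \<open>s = 0\<close>.\<close>
  proof (intro exI[of _ 1] allI impI)
    fix s :: complex assume "1 \<le> norm s"
    then have "s \<noteq> 0" by auto
    have "k = Suc (k - j - 1) + j" using j k by simp
    then have "s ^ k = s * s ^ (k - j - 1) * s ^ j" by (metis power_Suc power_add)
    then show "(char_partial A j s / s ^ j) / (poly ?P s / s ^ k) =
        s * (s ^ (k - j - 1) * (char_partial A j s / poly ?P s))"
      using \<open>s \<noteq> 0\<close> by (simp add: field_simps)
  qed
  ultimately show "((\<lambda>s. s * (s ^ (k - j - 1) * (char_partial A j s / poly ?P s)))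
      \<longlongrightarrow> char_coeff A j) at_infinity"
    by (rule Lim_transform_eventually)
qed

text \<open>
  The case \<open>j = k - 1\<close> of the representation, with the numerator reduced to a power: it turns the
  term \<open>a\<^sub>j s\<^sup>n / P(s)\<close> of the recursion step into a multiple of \<open>b\<^bsub>k-1\<^esub>(n)\<close>.
\<close>

lemma contour_integral_power_over_char_poly:
  assumes A: "A \<in> carrier_mat k k" and k: "k \<ge> 1" and n: "n \<ge> k"
    and R: "R > spectral_radius A"
  shows "((\<lambda>s. s ^ n / poly (char_poly A) s) has_contour_integral
    - contour_integral (circlepath 0 R)
      (\<lambda>s. s ^ (n - (k - 1) - 1) * (char_partial A (k - 1) s / poly (char_poly A) s)))
    (circlepath 0 R)"
proof -
  let ?P = "poly (char_poly A)"
  let ?g = "\<lambda>s. s ^ (n - (k - 1) - 1) * (char_partial A (k - 1) s / ?P s)"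
  have "((\<lambda>s. s ^ (n - k)) has_contour_integral 0) (circlepath 0 R)"
    by (rule Cauchy_theorem_convex_simple[where S = UNIV]) (auto intro!: holomorphic_intros)
  from has_contour_integral_diff[OF this
      has_contour_integral_integral[OF integrand_contour_integrable[OF A k R]]]
  have "((\<lambda>s. s ^ (n - k) - ?g s) has_contour_integral
      - contour_integral (circlepath 0 R) ?g) (circlepath 0 R)"
    by simp
  then show ?thesis
  proof (rule has_contour_integral_eq)
    fix s assume "s \<in> path_image (circlepath 0 R)"
    then have "norm s = R"
      using spectral_radius_nonneg[OF A k] R by (simp add: path_image_circlepath)
    then have nz: "?P s \<noteq> 0" using norm_less_if_char_poly_root[OF A k R, of s] by auto
    have "s ^ (n - k) - ?g s = s ^ (n - k) * (?P s - char_partial A (k - 1) s) / ?P s"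
      using nz k by (simp add: field_simps)
    also have "\<dots> = s ^ (n - k) * s ^ k / ?P s"
      by (simp add: poly_char_poly_eq_char_partial[OF A k])
    also have "\<dots> = s ^ n / ?P s"
      using n by (simp flip: power_add)
    finally show "s ^ (n - k) - ?g s = s ^ n / ?P s" .
  qed
qed

theorem lemma8:
  fixes A :: "complex mat" and k n j :: nat and R :: real
  assumes "k \<ge> 1"
    and "A \<in> carrier_mat k k"
    and "j \<le> k - 1"
    and "n \<ge> k"
    and "R > spectral_radius A"
  shows "pow_coeff A n j =
    - (1 / (2 * of_real pi * \<i>)) *
      contour_integral (circlepath 0 R)
        (\<lambda>s. s ^ (n - j - 1) * (char_partial A j s / poly (char_poly A) s))"
  using assms(4,3)
proof (induction n arbitrary: j rule: dec_induct)
  case base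
  have "pow_coeff A k j = - char_coeff A j"
    using pow_coeff_start[of A] assms(2) by auto
  then show ?case
    using contour_integral_initial[OF assms(2,1) base assms(5)] by simp
next
  case (step n)
  let ?P = "poly (char_poly A)"
  let ?G = "\<lambda>n j. (\<lambda>s. s ^ (n - j - 1) * (char_partial A j s / ?P s))"
  let ?I = "\<lambda>n j. contour_integral (circlepath 0 R) (?G n j)"
  let ?a = "char_coeff A j"
  have dim: "dim_row A = k" using assms(2) by auto
  have rec: "pow_coeff A (Suc n) j =
      (if j = 0 then 0 else pow_coeff A n (j - 1)) - ?a * pow_coeff A n (k - 1)"
    using pow_coeff_step[of A n j] step.hyps dim by simp
  have last: "((\<lambda>s. ?a * (s ^ n / ?P s)) has_contour_integral ?a * - ?I n (k - 1)) (circlepath 0 R)"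
    by (intro has_contour_integral_lmul
        contour_integral_power_over_char_poly[OF assms(2,1) _ assms(5)] step.hyps)
  have "?I (Suc n) j = (if j = 0 then 0 else ?I n (j - 1)) - ?a * ?I n (k - 1)"
  proof (cases j)
    case 0
    have "?G (Suc n) j = (\<lambda>s. ?a * (s ^ n / ?P s))"
      by (auto simp: 0 char_partial_0)
    then show ?thesis using contour_integral_unique[OF last] 0 by simp
  next
    case (Suc m)
    have n: "n = (n - m - 1) + j" "Suc n - j - 1 = n - m - 1"
      using step.hyps step.prems assms(1) Suc by auto
    have "?G (Suc n) j = (\<lambda>s. ?G n m s + ?a * (s ^ n / ?P s))"
    proof
      fix s :: complex
      have "s ^ n = s ^ (n - m - 1) * s ^ j" using n(1) by (metis power_add)
      then show "?G (Suc n) j s = ?G n m s + ?a * (s ^ n / ?P s)"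
        unfolding n(2) by (simp add: Suc char_partial_Suc ring_distribs add_divide_distrib)
    qed
    moreover have "(?G n m has_contour_integral ?I n m) (circlepath 0 R)"
      by (intro has_contour_integral_integral
          integrand_contour_integrable[OF assms(2,1,5)])
    ultimately show ?thesis
      using contour_integral_unique[OF has_contour_integral_add[OF _ last]] Suc by fastforce
  qed
  moreover have "pow_coeff A n (k - 1) = - (1 / (2 * of_real pi * \<i>)) * ?I n (k - 1)"
    by (rule step.IH) simp
  moreover have "pow_coeff A n (j - 1) = - (1 / (2 * of_real pi * \<i>)) * ?I n (j - 1)"
    by (rule step.IH) (use step.prems in simp)
  ultimately show ?case
    unfolding rec by (simp only: right_diff_distrib mult.left_commute mult_zero_right split: if_split) simp
qed

end
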